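(* Let $\theta>0$ and let $\mu=\mathrm{Beta}(1,\theta)$, i.e. the probability measure on $[0,1]$ with density $\theta(1-x)^{\theta-1}$. Then there exist infinitely many probability measures $\nu\neq\mu$ on $[0,1]$ such that $\nu(\{0\})=0$ and such that the residual allocation models from $\mu$ and from $\nu$ have identical Bernoulli($\tfrac12$) convolutions (i.e. the same law).
   Context: Residual allocation: given a Borel probability measure $\mu$ on $[0,1]$ with $\mu(\{0\})<1$, let $(Y_i)_{i\ge1}$ be i.i.d. random variables with law $\mu$ and set $X_1=Y_1$ and $X_i=Y_i\prod_{j=1}^{i-1}(1-Y_j)$ for $i\ge2$. Then almost surely $X_i\ge0$ and $\sum_{i\ge1}X_i=1$; the sequence $(X_i)_{i\ge1}$ is called the residual allocation model from $\mu$. Bernoulli($p$) convolution: let $(\varepsilon_i)_{i\ge1}$ be i.i.d. Bernoulli($p$) random variables (values in $\{0,1\}$, $P(\varepsilon_i=1)=p$), independent of $(X_i)_{i\ge1}$. The Bernoulli($p$) convolution of the residual allocation model from $\mu$ is the law of $Z=\sum_{i\ge1}\varepsilon_iX_i$. *)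

theory Defs
  imports "HOL-Probability.Probability"
begin

text \<open>
  Probability measures on $[0,1]$ are represented as Borel probability measures on the real line
  that give full mass to $[0,1]$.
\<close>

definition prob_on_unit :: "real measure \<Rightarrow> bool" where
  "prob_on_unit \<mu> \<longleftrightarrow> prob_space \<mu> \<and> sets \<mu> = sets borel \<and> emeasure \<mu> {0..1} = 1"

definition beta_one :: "real \<Rightarrow> real measure" where
  "beta_one \<theta> =
     density lborel (\<lambda>x. ennreal (\<theta> * (1 - x) powr (\<theta> - 1)) * indicator {0..1} x)"

text \<open>Sequences are indexed from 0, so the $X_i$ of the text is entry $i-1$.\<close>

definition residual_seq :: "(nat \<Rightarrow> real) \<Rightarrow> nat \<Rightarrow> real" where
  "residual_seq y i = y i * (\<Prod>j<i. 1 - y j)"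

text \<open>
  The residual allocation model from \<open>\<mu>\<close>, as a law on sequences, built on the canonical product
  space carrying an i.i.d. sequence with law \<open>\<mu>\<close>. The lemma \<open>distr_residual_seq\<close> below shows that
  any other i.i.d. sequence gives the same law.
\<close>

definition residual_allocation_model :: "real measure \<Rightarrow> (nat \<Rightarrow> real) measure" where
  "residual_allocation_model \<mu> =
     distr (\<Pi>\<^sub>M i\<in>UNIV. \<mu>) (\<Pi>\<^sub>M i\<in>UNIV. borel) residual_seq"

definition random_subsum :: "(nat \<Rightarrow> real) \<Rightarrow> (nat \<Rightarrow> bool) \<Rightarrow> real" where
  "random_subsum x e = (\<Sum>i. of_bool (e i) * x i)"

text \<open>
  The law of $\sum_i \varepsilon_i X_i$, where $X$ has law \<open>P\<close> and is independent of the i.i.d.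
  Bernoulli sequence $\varepsilon$. The series converges almost surely for the models considered;
  off that event \<^const>\<open>suminf\<close> takes an irrelevant value.
\<close>

definition bernoulli_convolution :: "real \<Rightarrow> (nat \<Rightarrow> real) measure \<Rightarrow> real measure" where
  "bernoulli_convolution p P =
     distr (P \<Otimes>\<^sub>M (\<Pi>\<^sub>M i\<in>UNIV. measure_pmf (bernoulli_pmf p))) borel
       (\<lambda>(x, e). random_subsum x e)"

text \<open>
  Measurability of the maps pushed forward above, and independence of the two laws from the
  choice of underlying probability space.
\<close>

lemma measurable_residual_seq [measurable]:
  "residual_seq \<in> (\<Pi>\<^sub>M i\<in>UNIV. borel) \<rightarrow>\<^sub>M (\<Pi>\<^sub>M i\<in>UNIV. borel)"
proof (rule measurable_PiM_single')
  show "(\<lambda>y. residual_seq y i) \<in> borel_measurable (\<Pi>\<^sub>M i\<in>UNIV. borel)" for i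
    unfolding residual_seq_def by measurable
qed auto

lemma measurable_random_subsum [measurable]:
  "(\<lambda>(x, e). random_subsum x e) \<in>
     borel_measurable ((\<Pi>\<^sub>M i\<in>UNIV. borel) \<Otimes>\<^sub>M (\<Pi>\<^sub>M i\<in>UNIV. measure_pmf (bernoulli_pmf p)))"
proof -
  have [measurable]: "(\<lambda>z. of_bool (snd z i) :: real) \<in>
      borel_measurable ((\<Pi>\<^sub>M i\<in>UNIV. borel :: real measure) \<Otimes>\<^sub>M
        (\<Pi>\<^sub>M i\<in>UNIV. measure_pmf (bernoulli_pmf p)))" for i :: nat
  proof -
    have 1: "(\<lambda>z. snd z i) \<in> ((\<Pi>\<^sub>M i\<in>UNIV. borel :: real measure) \<Otimes>\<^sub>M
        (\<Pi>\<^sub>M i\<in>UNIV. measure_pmf (bernoulli_pmf p))) \<rightarrow>\<^sub>M measure_pmf (bernoulli_pmf p)"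
      by measurable
    show ?thesis
      by (rule measurable_compose[OF 1]) simp
  qed
  have [measurable]: "(\<lambda>z. fst z i) \<in>
      borel_measurable ((\<Pi>\<^sub>M i\<in>UNIV. borel :: real measure) \<Otimes>\<^sub>M
        (\<Pi>\<^sub>M i\<in>UNIV. measure_pmf (bernoulli_pmf p)))" for i :: nat
    by measurable
  show ?thesis
    unfolding random_subsum_def case_prod_beta by measurable
qed

lemma distr_residual_seq:
  fixes Y :: "nat \<Rightarrow> 'a \<Rightarrow> real" and \<mu> :: "real measure"
  assumes "prob_space M" and indep: "prob_space.indep_vars M (\<lambda>_. borel) Y UNIV"
    and law: "\<And>i. distr M borel (Y i) = \<mu>"
  shows "distr M (\<Pi>\<^sub>M i\<in>UNIV. borel) (\<lambda>\<omega>. residual_seq (\<lambda>i. Y i \<omega>)) =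
    residual_allocation_model \<mu>"
proof -
  interpret prob_space M by fact
  have [measurable]: "Y i \<in> borel_measurable M" for i
    using indep by (auto simp: indep_vars_def)
  have [measurable]: "(\<lambda>\<omega> i. Y i \<omega>) \<in> M \<rightarrow>\<^sub>M (\<Pi>\<^sub>M i\<in>UNIV. borel)"
    by (rule measurable_PiM_single') auto
  have "distr M (\<Pi>\<^sub>M i\<in>UNIV. borel) (\<lambda>\<omega> i. Y i \<omega>) = (\<Pi>\<^sub>M i\<in>UNIV. \<mu>)"
    using indep_vars_iff_distr_eq_PiM[of UNIV Y "\<lambda>_. borel"] indep law
    by (simp add: restrict_UNIV)
  moreover have "distr M (\<Pi>\<^sub>M i\<in>UNIV. borel) (\<lambda>\<omega>. residual_seq (\<lambda>i. Y i \<omega>)) =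
      distr (distr M (\<Pi>\<^sub>M i\<in>UNIV. borel) (\<lambda>\<omega> i. Y i \<omega>)) (\<Pi>\<^sub>M i\<in>UNIV. borel) residual_seq"
    by (subst distr_distr) (auto simp: comp_def)
  ultimately show ?thesis
    by (simp add: residual_allocation_model_def)
qed

text \<open>
  Independence of \<open>X\<close> and \<open>\<epsilon>\<close> is expressed through the joint law, since
  \<^const>\<open>prob_space.indep_var\<close> requires both variables to have the same type.
\<close>

lemma distr_random_subsum:
  fixes X :: "'a \<Rightarrow> nat \<Rightarrow> real" and \<epsilon> :: "nat \<Rightarrow> 'a \<Rightarrow> bool" and p :: real
  defines "B \<equiv> measure_pmf (bernoulli_pmf p)"
  defines "S \<equiv> \<Pi>\<^sub>M i\<in>UNIV. borel" and "E \<equiv> \<Pi>\<^sub>M i\<in>UNIV. B"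
  assumes "prob_space M"
    and iid: "prob_space.indep_vars M (\<lambda>_. B) \<epsilon> UNIV" "\<And>i. distr M B (\<epsilon> i) = B"
    and X [measurable]: "X \<in> M \<rightarrow>\<^sub>M S" and law: "distr M S X = P"
    and indep: "distr M (S \<Otimes>\<^sub>M E) (\<lambda>\<omega>. (X \<omega>, \<lambda>i. \<epsilon> i \<omega>)) =
      distr M S X \<Otimes>\<^sub>M distr M E (\<lambda>\<omega> i. \<epsilon> i \<omega>)"
  shows "distr M borel (\<lambda>\<omega>. \<Sum>i. of_bool (\<epsilon> i \<omega>) * X \<omega> i) = bernoulli_convolution p P"
proof -
  interpret prob_space M by fact
  have rv: "\<epsilon> i \<in> M \<rightarrow>\<^sub>M B" for i
    using iid(1) by (auto simp: indep_vars_def)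
  have [measurable]: "(\<lambda>\<omega> i. \<epsilon> i \<omega>) \<in> M \<rightarrow>\<^sub>M E"
    unfolding E_def using rv by (intro measurable_PiM_single') (auto simp: B_def)
  have [measurable]: "(\<lambda>(x, e). random_subsum x e) \<in> borel_measurable (S \<Otimes>\<^sub>M E)"
    unfolding S_def E_def B_def by (rule measurable_random_subsum)
  have "distr M E (\<lambda>\<omega> i. \<epsilon> i \<omega>) = E"
    using indep_vars_iff_distr_eq_PiM[of UNIV \<epsilon> "\<lambda>_. B"] iid rv
    by (simp add: restrict_UNIV E_def)
  then have "distr M (S \<Otimes>\<^sub>M E) (\<lambda>\<omega>. (X \<omega>, \<lambda>i. \<epsilon> i \<omega>)) = P \<Otimes>\<^sub>M E"
    using indep law by simp
  moreover have "distr M borel (\<lambda>\<omega>. \<Sum>i. of_bool (\<epsilon> i \<omega>) * X \<omega> i) =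
      distr (distr M (S \<Otimes>\<^sub>M E) (\<lambda>\<omega>. (X \<omega>, \<lambda>i. \<epsilon> i \<omega>))) borel (\<lambda>(x, e). random_subsum x e)"
    by (subst distr_distr) (auto simp: comp_def random_subsum_def)
  ultimately show ?thesis
    by (simp add: bernoulli_convolution_def E_def B_def)
qed

end

theory Submission
  imports Defs
begin

text \<open>
  Splitting off the first stick shows that the law \<open>L\<close> of \<open>Z = \<Sum>i. \<epsilon>\<^sub>i X\<^sub>i\<close> solves the distributional
  equation \<open>Z = \<epsilon> Y + (1 - Y) Z'\<close>, where \<open>Y\<close> has law \<open>\<nu>\<close>, \<open>Z'\<close> has law \<open>L\<close> and \<open>\<epsilon>\<close>, \<open>Y\<close>, \<open>Z'\<close> are
  independent (\<open>residual_fixpoint_bernoulli_convolution\<close>). If \<open>\<nu>\<close> is not the point mass at \<open>0\<close>, the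
  equation has only one solution on \<open>[0,1]\<close>: the factor \<open>1 - Y\<close> makes it a contraction on
  characteristic functions (\<open>residual_fixpoint_unique\<close>). So it is enough to find one law \<open>L\<close> that
  solves the equation for infinitely many \<open>\<nu>\<close>, among them \<open>Beta(1, \<theta>)\<close>.

  Put \<open>a = \<theta> / 2\<close> and \<open>L = Beta(a, a)\<close>. As \<open>L\<close> is invariant under \<open>x \<mapsto> 1 - x\<close> and \<open>\<epsilon>\<close> is a fair coin,
  the right-hand side of the equation has the law of \<open>V Z\<close>, with \<open>V = 1 - Y\<close>, averaged with its own
  reflection. If \<open>V\<close> has the density \<open>2 a v^(2 a - 1) t(1 - v)\<close> with a polynomial \<open>t\<close>, then
  \<open>V Z\<close> has a density \<open>2 w(1 - x)\<close> with respect to \<open>L\<close>, where \<open>w\<close> is again a polynomial and \<open>w(0) = 0\<close>.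
  The equation therefore only asks for \<open>w(u) + w(1 - u) = 1\<close>, and this leaves the odd part of \<open>w\<close>
  about \<open>1/2\<close> free. The case \<open>t = 1\<close>, which is \<open>\<nu> = Beta(1, \<theta>)\<close>, gives \<open>w(u) = u\<close>. Adding
  \<open>s u (1 - u) (1 - 2 u)\<close> to \<open>w\<close> amounts to \<open>t = 1 + s q\<close> with a quadratic polynomial \<open>q\<close>, and every
  small \<open>s > 0\<close> keeps this nonnegative and so yields a different \<open>\<nu>\<close>
  (\<open>residual_fixpoint_symmetric_beta\<close>).
\<close>

section \<open>Laws on the unit interval\<close>

lemma prob_on_unitD:
  assumes "prob_on_unit \<mu>"
  shows "real_distribution \<mu>" and "AE x in \<mu>. 0 \<le> x \<and> x \<le> 1"
proof -
  have sets: "sets \<mu> = sets borel" and prob: "prob_space \<mu>" and mass: "emeasure \<mu> {0..1} = 1"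
    using assms by (auto simp: prob_on_unit_def)
  show "real_distribution \<mu>"
    using prob sets by (simp add: real_distribution_def real_distribution_axioms_def)
  interpret prob_space \<mu> by fact
  have "AE x in \<mu>. x \<in> {0..1}"
    using mass sets by (intro prob_eq_1[THEN iffD1]) (auto simp: measure_def)
  then show "AE x in \<mu>. 0 \<le> x \<and> x \<le> 1" by simp
qed

section \<open>Residual sequences\<close>

lemma sum_residual_seq: "(\<Sum>i<n. residual_seq y i) = 1 - (\<Prod>i<n. 1 - y i)"
  by (induction n) (auto simp: residual_seq_def algebra_simps)

lemma residual_seq_unit:
  assumes "\<forall>i. 0 \<le> y i \<and> y i \<le> 1"
  shows "residual_seq y i \<ge> 0" "summable (residual_seq y)" "(\<Sum>i. residual_seq y i) \<le> 1"
proof -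
  show nonneg: "residual_seq y i \<ge> 0" for i
    unfolding residual_seq_def using assms by (auto intro!: mult_nonneg_nonneg prod_nonneg)
  have bound: "(\<Sum>i<n. residual_seq y i) \<le> 1" for n
    unfolding sum_residual_seq using assms by (auto intro!: prod_nonneg)
  show "summable (residual_seq y)"
    by (rule summableI_nonneg_bounded[OF nonneg bound])
  then show "(\<Sum>i. residual_seq y i) \<le> 1"
    by (rule suminf_le_const) (rule bound)
qed

lemma summable_random_subsum:
  assumes "\<And>i. x i \<ge> 0" "summable x"
  shows "summable (\<lambda>i. of_bool (e i) * x i :: real)"
  by (rule summable_comparison_test'[OF assms(2), of 0]) (use assms(1) in auto)

lemma random_subsum_unit:
  assumes "\<forall>i. 0 \<le> y i \<and> y i \<le> 1"
  shows "0 \<le> random_subsum (residual_seq y) e" "random_subsum (residual_seq y) e \<le> 1"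
proof -
  note X = residual_seq_unit[OF assms]
  have s: "summable (\<lambda>i. of_bool (e i) * residual_seq y i)"
    by (rule summable_random_subsum[OF X(1,2)])
  show "0 \<le> random_subsum (residual_seq y) e"
    unfolding random_subsum_def using s X(1) by (intro suminf_nonneg) auto
  have "random_subsum (residual_seq y) e \<le> (\<Sum>i. residual_seq y i)"
    unfolding random_subsum_def using X by (intro suminf_le s) auto
  with X(3) show "random_subsum (residual_seq y) e \<le> 1" by linarith
qed

text \<open>
  After the first piece \<open>y0\<close> is broken off, the rest of the stick, of length \<open>1 - y0\<close>, is divided by
  the same rule.
\<close>

lemma random_subsum_residual_seq_case_nat:
  assumes "\<forall>i. 0 \<le> y i \<and> y i \<le> 1"
  shows "random_subsum (residual_seq (case_nat y0 y)) (case_nat e0 e) =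
    of_bool e0 * y0 + (1 - y0) * random_subsum (residual_seq y) e"
proof -
  have Suc: "residual_seq (case_nat y0 y) (Suc i) = (1 - y0) * residual_seq y i" for i
    unfolding residual_seq_def by (subst prod.lessThan_Suc_shift) simp
  let ?g = "\<lambda>i. of_bool (e i) * residual_seq y i"
  have s: "summable ?g"
    by (intro summable_random_subsum residual_seq_unit assms)
  let ?f = "\<lambda>i. of_bool (case_nat e0 e i) * residual_seq (case_nat y0 y) i"
  have shift: "?f (Suc i) = (1 - y0) * ?g i" for i
    by (simp add: Suc)
  have "(\<lambda>i. (1 - y0) * ?g i) sums ((1 - y0) * suminf ?g)"
    by (rule sums_mult[OF summable_sums[OF s]])
  then have "(\<lambda>i. ?f (Suc i)) sums ((1 - y0) * suminf ?g)"
    unfolding shift .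
  then have "?f sums ((1 - y0) * suminf ?g + ?f 0)"
    by (rule sums_Suc)
  then show ?thesis
    unfolding random_subsum_def by (simp add: sums_iff residual_seq_def)
qed

section \<open>The distributional equation\<close>

text \<open>
  The equation \<open>Z = \<epsilon> Y + (1 - Y) Z'\<close> in law. Testing against nonnegative Borel functions makes it
  meaningful for every measure \<open>\<nu>\<close>, so that the equation itself can be used to find the total mass
  of \<open>\<nu>\<close>.
\<close>

definition residual_fixpoint :: "real \<Rightarrow> real measure \<Rightarrow> real measure \<Rightarrow> bool" where
  "residual_fixpoint p \<nu> L \<longleftrightarrow> (\<forall>f \<in> borel_measurable borel.
     (\<integral>\<^sup>+z. f z \<partial>L) =
     (\<integral>\<^sup>+y. (\<integral>\<^sup>+z. f (y + (1 - y) * z) \<partial>L) * ennreal p +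
           (\<integral>\<^sup>+z. f ((1 - y) * z) \<partial>L) * ennreal (1 - p) \<partial>\<nu>))"

lemma nn_integral_bernoulli_convolution:
  assumes "prob_on_unit \<nu>" and [measurable]: "f \<in> borel_measurable borel"
  shows "(\<integral>\<^sup>+z. f z \<partial>bernoulli_convolution p (residual_allocation_model \<nu>)) =
    (\<integral>\<^sup>+y. \<integral>\<^sup>+e. f (random_subsum (residual_seq y) e)
       \<partial>(\<Pi>\<^sub>M i\<in>UNIV. measure_pmf (bernoulli_pmf p)) \<partial>(\<Pi>\<^sub>M i\<in>UNIV. \<nu>))"
proof -
  interpret real_distribution \<nu> by (rule prob_on_unitD) fact
  let ?E = "\<Pi>\<^sub>M i\<in>(UNIV :: nat set). measure_pmf (bernoulli_pmf p)"
  interpret E: product_prob_space "\<lambda>_. measure_pmf (bernoulli_pmf p)" "UNIV :: nat set"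
    by standard
  have [measurable]: "residual_seq \<in> (\<Pi>\<^sub>M i\<in>UNIV. \<nu>) \<rightarrow>\<^sub>M (\<Pi>\<^sub>M i\<in>UNIV. borel)"
    by (subst measurable_cong_sets[OF sets_PiM_cong refl]) auto
  have [measurable]: "(\<lambda>(x, e). random_subsum x e)
      \<in> borel_measurable (residual_allocation_model \<nu> \<Otimes>\<^sub>M ?E)"
    unfolding residual_allocation_model_def
    by (subst measurable_cong_sets[OF sets_pair_measure_cong refl]) auto
  have "(\<lambda>(x, e). f (random_subsum x e)) \<in>
      borel_measurable (residual_allocation_model \<nu> \<Otimes>\<^sub>M ?E)"
    using measurable_compose[OF \<open>(\<lambda>(x, e). random_subsum x e) \<in> _\<close> assms(2)]
    by (simp add: case_prod_beta)
  note E.borel_measurable_nn_integral_fst[OF this] E.nn_integral_fst[OF this]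
  then show ?thesis
    unfolding bernoulli_convolution_def
    by (subst nn_integral_distr)
       (auto simp: case_prod_beta residual_allocation_model_def nn_integral_distr
             simp flip: E.nn_integral_fst)
qed

lemma AE_PiM_unit:
  assumes "prob_on_unit \<nu>"
  shows "AE y in (\<Pi>\<^sub>M i\<in>UNIV. \<nu>). \<forall>i::nat. 0 \<le> y i \<and> y i \<le> 1"
proof -
  interpret real_distribution \<nu> by (rule prob_on_unitD) fact
  interpret product_prob_space "\<lambda>_. \<nu>" "UNIV :: nat set" by standard
  show ?thesis
    unfolding AE_all_countable
    by (intro allI AE_component[OF _ prob_on_unitD(2)[OF assms]]) simp
qed

lemma prob_on_unit_bernoulli_convolution:
  assumes "prob_on_unit \<nu>"
  shows "prob_on_unit (bernoulli_convolution p (residual_allocation_model \<nu>))"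
proof -
  interpret real_distribution \<nu> by (rule prob_on_unitD) fact
  interpret N: product_prob_space "\<lambda>_. \<nu>" "UNIV :: nat set" by standard
  let ?E = "\<Pi>\<^sub>M i\<in>(UNIV :: nat set). measure_pmf (bernoulli_pmf p)"
  interpret E: product_prob_space "\<lambda>_. measure_pmf (bernoulli_pmf p)" "UNIV :: nat set"
    by standard
  let ?L = "bernoulli_convolution p (residual_allocation_model \<nu>)"
  have sets: "sets ?L = sets borel" by (simp add: bernoulli_convolution_def)
  have "emeasure ?L A = 1" if [measurable]: "A \<in> sets borel" and A: "{0..1} \<subseteq> A" for A
  proof -
    have "emeasure ?L A = (\<integral>\<^sup>+z. indicator A z \<partial>?L)"
      using that sets by simp
    also have "\<dots> = (\<integral>\<^sup>+y. \<integral>\<^sup>+e. indicator A (random_subsum (residual_seq y) e) \<partial>?E \<partial>(\<Pi>\<^sub>M i\<in>UNIV. \<nu>))"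
      by (rule nn_integral_bernoulli_convolution[OF assms]) simp
    also have "\<dots> = (\<integral>\<^sup>+y. \<integral>\<^sup>+e. 1 \<partial>?E \<partial>(\<Pi>\<^sub>M i\<in>(UNIV :: nat set). \<nu>))"
    proof (rule nn_integral_cong_AE)
      show "AE y in (\<Pi>\<^sub>M i\<in>UNIV. \<nu>). (\<integral>\<^sup>+e. indicator A (random_subsum (residual_seq y) e) \<partial>?E) =
          (\<integral>\<^sup>+e. 1 \<partial>?E)"
        using AE_PiM_unit[OF assms]
      proof eventually_elim
        case (elim y)
        have "random_subsum (residual_seq y) e \<in> A" for e
          using random_subsum_unit[OF elim, of e] A by fastforce
        then show ?case by simp
      qed
    qed
    also have "\<dots> = 1" by (simp add: E.emeasure_space_1 N.emeasure_space_1)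
    finally show ?thesis .
  qed
  from this[of UNIV] this[of "{0..1}"] sets show ?thesis
    by (auto simp: prob_on_unit_def intro!: prob_spaceI)
       (auto simp: bernoulli_convolution_def)
qed

text \<open>
  The product measure on sequences is the law of a sequence with an independent entry put in front,
  so both the \<open>Y\<^sub>i\<close> and the \<open>\<epsilon>\<^sub>i\<close> can be split into their first entry and an independent copy of the
  whole sequence.
\<close>

lemma residual_fixpoint_bernoulli_convolution:
  assumes \<nu>: "prob_on_unit \<nu>" and p: "0 \<le> p" "p \<le> 1"
  shows "residual_fixpoint p \<nu> (bernoulli_convolution p (residual_allocation_model \<nu>))"
  unfolding residual_fixpoint_def
proof
  fix f :: "real \<Rightarrow> ennreal" assume f [measurable]: "f \<in> borel_measurable borel"
  interpret real_distribution \<nu> by (rule prob_on_unitD) fact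
  let ?b = "measure_pmf (bernoulli_pmf p)"
  interpret N: sequence_space \<nu> by standard
  interpret E: sequence_space ?b by standard
  let ?L = "bernoulli_convolution p (residual_allocation_model \<nu>)"
  let ?Z = "\<lambda>y e. random_subsum (residual_seq y) e"
  have [measurable]: "residual_seq \<in> N.S \<rightarrow>\<^sub>M (\<Pi>\<^sub>M i\<in>UNIV. borel)"
    by (subst measurable_cong_sets[OF sets_PiM_cong refl]) auto
  have Z [measurable]: "(\<lambda>(y, e). ?Z y e) \<in> borel_measurable (N.S \<Otimes>\<^sub>M E.S)"
  proof -
    have "(\<lambda>(y, e). (residual_seq y, e)) \<in> N.S \<Otimes>\<^sub>M E.S \<rightarrow>\<^sub>M (\<Pi>\<^sub>M i\<in>UNIV. borel) \<Otimes>\<^sub>M E.S"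
      by measurable
    from measurable_compose[OF this measurable_random_subsum] show ?thesis
      by (simp add: case_prod_beta)
  qed
  have [measurable]: "?Z y \<in> borel_measurable E.S" if "y \<in> space N.S" for y
    using measurable_compose_Pair1[OF that Z] by simp
  have E_iter: "(\<integral>\<^sup>+e. g e \<partial>E.S) = (\<integral>\<^sup>+e. g (case_nat True e) \<partial>E.S) * ennreal p +
      (\<integral>\<^sup>+e. g (case_nat False e) \<partial>E.S) * ennreal (1 - p)"
    if g [measurable]: "g \<in> borel_measurable E.S" for g :: "(nat \<Rightarrow> bool) \<Rightarrow> ennreal"
  proof -
    have m: "(\<lambda>(s, \<omega>). case_nat s \<omega>) \<in> ?b \<Otimes>\<^sub>M E.S \<rightarrow>\<^sub>M E.S" by measurable
    have "(\<integral>\<^sup>+e. g e \<partial>E.S) = (\<integral>\<^sup>+e. g e \<partial>distr (?b \<Otimes>\<^sub>M E.S) E.S (\<lambda>(s, \<omega>). case_nat s \<omega>))"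
      by (simp add: E.PiM_iter)
    also have "\<dots> = (\<integral>\<^sup>+e0. \<integral>\<^sup>+e. g (case_nat e0 e) \<partial>E.S \<partial>?b)"
      using m by (simp add: nn_integral_distr case_prod_beta flip: E.nn_integral_fst)
    finally show ?thesis using p by simp
  qed
  have N_iter: "(\<integral>\<^sup>+y. g y \<partial>N.S) = (\<integral>\<^sup>+y0. \<integral>\<^sup>+y. g (case_nat y0 y) \<partial>N.S \<partial>\<nu>)"
    if g [measurable]: "g \<in> borel_measurable N.S" for g :: "(nat \<Rightarrow> real) \<Rightarrow> ennreal"
  proof -
    have m: "(\<lambda>(s, \<omega>). case_nat s \<omega>) \<in> \<nu> \<Otimes>\<^sub>M N.S \<rightarrow>\<^sub>M N.S" by measurable
    have "(\<integral>\<^sup>+e. g e \<partial>N.S) = (\<integral>\<^sup>+e. g e \<partial>distr (\<nu> \<Otimes>\<^sub>M N.S) N.S (\<lambda>(s, \<omega>). case_nat s \<omega>))"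
      by (simp add: N.PiM_iter)
    also have "\<dots> = (\<integral>\<^sup>+e0. \<integral>\<^sup>+e. g (case_nat e0 e) \<partial>N.S \<partial>\<nu>)"
      using m by (simp add: nn_integral_distr case_prod_beta flip: N.nn_integral_fst)
    finally show ?thesis .
  qed
  have L: "(\<integral>\<^sup>+z. h z \<partial>?L) = (\<integral>\<^sup>+y. \<integral>\<^sup>+e. h (?Z y e) \<partial>E.S \<partial>N.S)"
    if "h \<in> borel_measurable borel" for h
    by (rule nn_integral_bernoulli_convolution[OF \<nu> that])
  have pair: "(\<lambda>y. \<integral>\<^sup>+e. h (?Z y e) \<partial>E.S) \<in> borel_measurable N.S"
    if [measurable]: "h \<in> borel_measurable borel" for h :: "real \<Rightarrow> ennreal"
    by measurable
  have "(\<integral>\<^sup>+z. f z \<partial>?L) = (\<integral>\<^sup>+y0. \<integral>\<^sup>+y. \<integral>\<^sup>+e. f (?Z (case_nat y0 y) e) \<partial>E.S \<partial>N.S \<partial>\<nu>)"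
    unfolding L[OF f] by (rule N_iter[OF pair[OF f]])
  also have "\<dots> = (\<integral>\<^sup>+y0. (\<integral>\<^sup>+y. (\<integral>\<^sup>+e. f (y0 + (1 - y0) * ?Z y e) \<partial>E.S) * ennreal p +
      (\<integral>\<^sup>+e. f ((1 - y0) * ?Z y e) \<partial>E.S) * ennreal (1 - p) \<partial>N.S) \<partial>\<nu>)"
  proof (rule nn_integral_cong)
    fix y0 :: real
    show "(\<integral>\<^sup>+y. \<integral>\<^sup>+e. f (?Z (case_nat y0 y) e) \<partial>E.S \<partial>N.S) =
        (\<integral>\<^sup>+y. (\<integral>\<^sup>+e. f (y0 + (1 - y0) * ?Z y e) \<partial>E.S) * ennreal p +
          (\<integral>\<^sup>+e. f ((1 - y0) * ?Z y e) \<partial>E.S) * ennreal (1 - p) \<partial>N.S)"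
    proof (rule nn_integral_cong_AE, use AE_PiM_unit[OF \<nu>] in eventually_elim)
      case (elim y)
      have "case_nat y0 y \<in> space N.S" by (simp add: space_PiM)
      then have m: "(\<lambda>e. f (?Z (case_nat y0 y) e)) \<in> borel_measurable E.S" by measurable
      show ?case
        using elim by (subst E_iter[OF m]) (simp add: random_subsum_residual_seq_case_nat)
    qed
  qed
  also have "\<dots> = (\<integral>\<^sup>+y0. (\<integral>\<^sup>+z. f (y0 + (1 - y0) * z) \<partial>?L) * ennreal p +
      (\<integral>\<^sup>+z. f ((1 - y0) * z) \<partial>?L) * ennreal (1 - p) \<partial>\<nu>)"
  proof (rule nn_integral_cong)
    fix y0 :: real
    have "(\<lambda>z. f (y0 + (1 - y0) * z)) \<in> borel_measurable borel"
      "(\<lambda>z. f ((1 - y0) * z)) \<in> borel_measurable borel"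
      by measurable
    then show "(\<integral>\<^sup>+y. (\<integral>\<^sup>+e. f (y0 + (1 - y0) * ?Z y e) \<partial>E.S) * ennreal p +
          (\<integral>\<^sup>+e. f ((1 - y0) * ?Z y e) \<partial>E.S) * ennreal (1 - p) \<partial>N.S) =
        (\<integral>\<^sup>+z. f (y0 + (1 - y0) * z) \<partial>?L) * ennreal p +
        (\<integral>\<^sup>+z. f ((1 - y0) * z) \<partial>?L) * ennreal (1 - p)"
      by (subst nn_integral_add) (auto simp: nn_integral_multc pair L)
  qed
  finally show "(\<integral>\<^sup>+z. f z \<partial>?L) = (\<integral>\<^sup>+y. (\<integral>\<^sup>+z. f (y + (1 - y) * z) \<partial>?L) * ennreal p +
      (\<integral>\<^sup>+z. f ((1 - y) * z) \<partial>?L) * ennreal (1 - p) \<partial>\<nu>)" .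
qed

section \<open>Uniqueness of the solution\<close>

lemma norm_integral_le_integral_AE:
  fixes f :: "'a \<Rightarrow> 'b :: {banach, second_countable_topology}"
  assumes "integrable M f" "integrable M g" "AE x in M. norm (f x) \<le> g x"
  shows "norm (\<integral>x. f x \<partial>M) \<le> (\<integral>x. g x \<partial>M)"
  using integral_norm_bound[of M f] integral_mono_AE[OF integrable_norm[OF assms(1)] assms(2,3)]
  by linarith

lemma char_residual_fixpoint:
  assumes fp: "residual_fixpoint p \<nu> L" and \<nu>: "prob_on_unit \<nu>" and L: "prob_on_unit L"
    and p: "0 \<le> p" "p \<le> 1"
  shows "char L t = (CLINT y|\<nu>. (iexp (t * y) * of_real p + of_real (1 - p)) * char L (t * (1 - y)))"
proof -
  interpret real_distribution \<nu> by (rule prob_on_unitD) fact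
  interpret L: real_distribution L by (rule prob_on_unitD) fact
  let ?b = "measure_pmf (bernoulli_pmf p)"
  interpret bL: pair_prob_space ?b L ..
  interpret NbL: pair_prob_space \<nu> "?b \<Otimes>\<^sub>M L" ..
  let ?g = "\<lambda>(y, e, z). of_bool e * y + (1 - y) * z :: real"
  have [measurable]: "(\<lambda>w. of_bool (fst (snd w)) :: real) \<in> borel_measurable (\<nu> \<Otimes>\<^sub>M ?b \<Otimes>\<^sub>M L)"
    by (rule measurable_compose[of "\<lambda>w. fst (snd w)" _ ?b]) auto
  have g [measurable]: "?g \<in> borel_measurable (\<nu> \<Otimes>\<^sub>M ?b \<Otimes>\<^sub>M L)"
    unfolding case_prod_beta by measurable
  have distr: "L = distr (\<nu> \<Otimes>\<^sub>M ?b \<Otimes>\<^sub>M L) borel ?g"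
  proof (rule measure_eqI)
    fix A assume "A \<in> sets L"
    then have A [measurable]: "A \<in> sets borel" by simp
    have ind: "(\<lambda>w. indicator A (?g w) :: ennreal) \<in> borel_measurable (\<nu> \<Otimes>\<^sub>M ?b \<Otimes>\<^sub>M L)"
      by measurable
    have "emeasure L A = (\<integral>\<^sup>+z. indicator A z \<partial>L)" by simp
    also have "\<dots> = (\<integral>\<^sup>+y. \<integral>\<^sup>+e. \<integral>\<^sup>+z. indicator A (?g (y, e, z)) \<partial>L \<partial>?b \<partial>\<nu>)"
      using p by (subst fp[unfolded residual_fixpoint_def, THEN bspec, of "indicator A"]) auto
    also have "\<dots> = (\<integral>\<^sup>+y. \<integral>\<^sup>+ez. indicator A (?g (y, ez)) \<partial>(?b \<Otimes>\<^sub>M L) \<partial>\<nu>)"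
    proof (rule nn_integral_cong)
      fix y
      have "(\<lambda>w. indicator A (?g (y, w)) :: ennreal) \<in> borel_measurable (?b \<Otimes>\<^sub>M L)"
        by (rule measurable_compose_Pair1[OF _ ind]) simp
      from L.nn_integral_fst[OF this]
      show "(\<integral>\<^sup>+e. \<integral>\<^sup>+z. indicator A (?g (y, e, z)) \<partial>L \<partial>?b) =
        (\<integral>\<^sup>+ez. indicator A (?g (y, ez)) \<partial>(?b \<Otimes>\<^sub>M L))" .
    qed
    also have "\<dots> = (\<integral>\<^sup>+w. indicator A (?g w) \<partial>(\<nu> \<Otimes>\<^sub>M ?b \<Otimes>\<^sub>M L))"
      by (rule bL.nn_integral_fst[OF ind])
    also have "\<dots> = (\<integral>\<^sup>+z. indicator A z \<partial>distr (\<nu> \<Otimes>\<^sub>M ?b \<Otimes>\<^sub>M L) borel ?g)"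
      by (subst nn_integral_distr) auto
    also have "\<dots> = emeasure (distr (\<nu> \<Otimes>\<^sub>M ?b \<Otimes>\<^sub>M L) borel ?g) A" by simp
    finally show "emeasure L A = emeasure (distr (\<nu> \<Otimes>\<^sub>M ?b \<Otimes>\<^sub>M L) borel ?g) A" .
  qed simp
  let ?h = "\<lambda>w. iexp (t * ?g w)"
  have h: "integrable (\<nu> \<Otimes>\<^sub>M ?b \<Otimes>\<^sub>M L) ?h"
    by (rule NbL.P.integrable_const_bound[of _ 1]) auto
  have "char L t = (CLINT w|(\<nu> \<Otimes>\<^sub>M ?b \<Otimes>\<^sub>M L). ?h w)"
    unfolding char_def by (subst distr, subst integral_distr) auto
  also have "\<dots> = (CLINT y|\<nu>. CLINT ez|(?b \<Otimes>\<^sub>M L). ?h (y, ez))"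
    by (rule NbL.integral_fst'[OF h, symmetric])
  also have "\<dots> = (CLINT y|\<nu>. (iexp (t * y) * of_real p + of_real (1 - p)) * char L (t * (1 - y)))"
  proof (rule Bochner_Integration.integral_cong[OF refl])
    fix y
    have "integrable (?b \<Otimes>\<^sub>M L) (\<lambda>ez. ?h (y, ez))"
      using measurable_compose_Pair1[OF _ borel_measurable_integrable[OF h], of y]
      by (intro bL.P.integrable_const_bound[of _ 1]) auto
    from bL.integral_fst'[OF this]
    have "(CLINT ez|(?b \<Otimes>\<^sub>M L). ?h (y, ez)) = (CLINT e|?b. CLINT z|L. ?h (y, e, z))" by simp
    also have "\<dots> = (CLINT z|L. iexp (t * (y + (1 - y) * z))) * p +
        (CLINT z|L. iexp (t * ((1 - y) * z))) * (1 - p)"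
      using p by (subst integral_measure_pmf[of UNIV])
        (auto simp: UNIV_bool scaleR_conv_of_real mult_ac)
    also have "(CLINT z|L. iexp (t * (y + (1 - y) * z))) = iexp (t * y) * char L (t * (1 - y))"
      unfolding char_def by (simp add: ring_distribs exp_add mult_ac flip: integral_mult_right_zero)
    also have "(CLINT z|L. iexp (t * ((1 - y) * z))) = char L (t * (1 - y))"
      unfolding char_def by (simp add: mult_ac)
    finally show "(CLINT ez|(?b \<Otimes>\<^sub>M L). ?h (y, ez)) =
        (iexp (t * y) * of_real p + of_real (1 - p)) * char L (t * (1 - y))"
      by (simp add: algebra_simps)
  qed
  finally show ?thesis .
qed

lemma norm_char_minus_1_le:
  assumes "prob_on_unit L"
  shows "norm (char L t - 1) \<le> \<bar>t\<bar>"
proof -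
  interpret real_distribution L by (rule prob_on_unitD) fact
  have int: "integrable L (\<lambda>x. iexp (t * x))"
    by (rule integrable_const_bound[of _ 1]) auto
  have "char L t - 1 = (CLINT x|L. iexp (t * x) - 1)"
    unfolding char_def using int by (simp add: prob_space[simplified])
  also have "norm \<dots> \<le> (\<integral>x. \<bar>t\<bar> \<partial>L)"
  proof (rule norm_integral_le_integral_AE)
    show "integrable L (\<lambda>x. iexp (t * x) - 1)" using int by simp
    show "AE x in L. norm (iexp (t * x) - 1) \<le> \<bar>t\<bar>"
      using prob_on_unitD(2)[OF assms]
    proof eventually_elim
      case (elim x)
      have "norm (iexp (t * x) - 1) \<le> \<bar>t * x\<bar>"
        using iexp_approx1[of "t * x" 0] by simp
      also have "\<dots> \<le> \<bar>t\<bar>"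
        using elim by (auto simp: abs_mult intro: mult_left_le)
      finally show ?case .
    qed
  qed auto
  finally show ?thesis by (simp add: prob_space[simplified])
qed

text \<open>
  Let \<open>D t\<close> be the distance of the characteristic functions of two solutions at \<open>t\<close>, and let \<open>r\<close> be
  the mean of \<open>1 - Y\<close>. The equation gives \<open>D t \<le> E (D (t (1 - Y)))\<close>, so a bound \<open>D t \<le> c \<bar>t\<bar>\<close> for
  all \<open>t\<close> improves to \<open>D t \<le> c r \<bar>t\<bar>\<close>. The law \<open>\<nu>\<close> is not concentrated at \<open>0\<close>, whence \<open>r < 1\<close>.
\<close>

lemma residual_fixpoint_unique:
  assumes "residual_fixpoint p \<nu> L" "residual_fixpoint p \<nu> L'"
    and \<nu>: "prob_on_unit \<nu>" "emeasure \<nu> {0} < 1" and L: "prob_on_unit L" "prob_on_unit L'"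
    and p: "0 \<le> p" "p \<le> 1"
  shows "L = L'"
proof -
  interpret real_distribution \<nu> by (rule prob_on_unitD) fact
  interpret L: real_distribution L by (rule prob_on_unitD) fact
  interpret L': real_distribution L' by (rule prob_on_unitD) fact
  have unit: "AE y in \<nu>. 0 \<le> y \<and> y \<le> 1" by (rule prob_on_unitD) fact
  define r where "r = (\<integral>y. 1 - y \<partial>\<nu>)"
  have int_id: "integrable \<nu> (\<lambda>y. y)"
    by (rule integrable_const_bound[of _ 1]) (use unit in \<open>auto elim: eventually_mono\<close>)
  have "(\<integral>y. y \<partial>\<nu>) \<noteq> 0"
  proof
    assume "(\<integral>y. y \<partial>\<nu>) = 0"
    then have "AE y in \<nu>. y = 0"
      using integral_nonneg_eq_0_iff_AE[OF int_id] unit by (auto elim: eventually_mono)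
    then have "prob {0} = 1"
      by (intro prob_eq_1[THEN iffD2]) auto
    with \<nu>(2) show False by (simp add: emeasure_eq_measure)
  qed
  moreover have "(\<integral>y. y \<partial>\<nu>) \<ge> 0"
    using unit by (intro integral_nonneg_AE) (auto elim: eventually_mono)
  moreover have r_eq: "r = 1 - (\<integral>y. y \<partial>\<nu>)"
    unfolding r_def using int_id by (simp add: prob_space[simplified])
  ultimately have r1: "r < 1" by simp
  have r0: "r \<ge> 0"
    unfolding r_def using unit by (intro integral_nonneg_AE) (auto elim: eventually_mono)
  define D where "D t = norm (char L t - char L' t)" for t
  have step: "D t \<le> (\<integral>y. c * \<bar>t\<bar> * (1 - y) \<partial>\<nu>)" if c: "\<And>t. D t \<le> c * \<bar>t\<bar>" for c t
  proof -
    let ?w = "\<lambda>y. iexp (t * y) * of_real p + of_real (1 - p)"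
    have w: "norm (?w y) \<le> 1" for y
    proof -
      have "norm (?w y) \<le> norm (iexp (t * y) * of_real p) + norm (complex_of_real (1 - p))"
        by (rule norm_triangle_ineq)
      also have "\<dots> = 1"
        using p by (simp add: norm_mult del: of_real_diff of_real_add)
      finally show ?thesis .
    qed
    have int: "integrable \<nu> (\<lambda>y. ?w y * char K (t * (1 - y)))" if "real_distribution K" for K
    proof -
      interpret K: real_distribution K by fact
      show ?thesis
      proof (rule integrable_const_bound[of _ 1])
        show "AE y in \<nu>. norm (?w y * char K (t * (1 - y))) \<le> 1"
          unfolding norm_mult using w K.cmod_char_le_1 by (auto intro!: AE_I2 mult_le_one)
      qed measurable
    qed
    note ints = int[OF L.real_distribution_axioms] int[OF L'.real_distribution_axioms]
    have "D t = norm (CLINT y|\<nu>. ?w y * char L (t * (1 - y)) - ?w y * char L' (t * (1 - y)))"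
      unfolding D_def char_residual_fixpoint[OF assms(1) \<nu>(1) L(1) p, of t]
        char_residual_fixpoint[OF assms(2) \<nu>(1) L(2) p, of t]
      using ints by simp
    also have "\<dots> \<le> (\<integral>y. c * \<bar>t\<bar> * (1 - y) \<partial>\<nu>)"
    proof (rule norm_integral_le_integral_AE)
      show "integrable \<nu> (\<lambda>y. c * \<bar>t\<bar> * (1 - y))" using int_id by simp
      show "AE y in \<nu>. norm (?w y * char L (t * (1 - y)) - ?w y * char L' (t * (1 - y)))
          \<le> c * \<bar>t\<bar> * (1 - y)"
        using unit
      proof eventually_elim
        case (elim y)
        have "norm (?w y * char L (t * (1 - y)) - ?w y * char L' (t * (1 - y))) =
            norm (?w y) * D (t * (1 - y))"
          unfolding D_def norm_mult[symmetric] by (simp add: algebra_simps)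
        also have "\<dots> \<le> 1 * D (t * (1 - y))"
          by (intro mult_right_mono w) (simp add: D_def)
        also have "\<dots> \<le> c * \<bar>t * (1 - y)\<bar>" using c by simp
        finally show ?case using elim by (simp add: abs_mult mult_ac)
      qed
    qed (use ints in auto)
    finally show ?thesis .
  qed
  have bound: "D t \<le> 2 * r ^ n * \<bar>t\<bar>" for n t
  proof (induction n arbitrary: t)
    case 0
    show ?case
      using norm_char_minus_1_le[OF L(1), of t] norm_char_minus_1_le[OF L(2), of t]
        norm_triangle_ineq4[of "char L t - 1" "char L' t - 1"] by (simp add: D_def)
  next
    case (Suc n)
    from step[OF Suc] show ?case by (simp add: r_def[symmetric] mult_ac)
  qed
  have "char L t = char L' t" for t
  proof -
    have "(\<lambda>n. 2 * r ^ n * \<bar>t\<bar>) \<longlonglongrightarrow> 2 * 0 * \<bar>t\<bar>"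
      using r0 r1 by (intro tendsto_intros LIMSEQ_realpow_zero) auto
    then have "D t \<le> 0"
      using bound by (intro LIMSEQ_le_const[of _ _ "D t"]) auto
    then show ?thesis by (simp add: D_def)
  qed
  then show ?thesis
    by (intro Levy_uniqueness L.real_distribution_axioms L'.real_distribution_axioms) auto
qed

section \<open>Densities and polynomial weights\<close>

definition symmetric_beta :: "real \<Rightarrow> real measure" where
  "symmetric_beta a =
     density lborel (\<lambda>x. ennreal (x powr (a - 1) * (1 - x) powr (a - 1) / Beta a a) * indicator {0..1} x)"

text \<open>
  The quadratic polynomial \<open>q\<close> for which \<open>r^(a - 1) q(d - r)\<close> integrates over \<open>[0, d]\<close> to
  \<open>d^a (1 - d) (1 - 2 d) / a\<close>. Its coefficients result from
  \<open>\<integral> r^(a - 1) (d - r)^k dr = k! d^(a + k) / (a (a + 1) \<dots> (a + k))\<close>.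
\<close>

definition tilt :: "real \<Rightarrow> real \<Rightarrow> real" where
  "tilt a y = 1 - 3 * (a + 1) * y + (a + 1) * (a + 2) * y\<^sup>2"

text \<open>A perturbation of \<open>Beta(1, 2 a)\<close>, which is the case \<open>s = 0\<close>.\<close>

definition tilted_beta :: "real \<Rightarrow> real \<Rightarrow> real measure" where
  "tilted_beta a s = density lborel
     (\<lambda>y. ennreal (2 * a * (1 - y) powr (2 * a - 1) * (1 + s * tilt a y)) * indicator {0..1} y)"

text \<open>
  Half the density of \<open>(1 - Y) Z\<close> with respect to the law of \<open>Z\<close>, as a function of \<open>u = 1 - x\<close>, when
  \<open>Y\<close> has law \<^term>\<open>tilted_beta a s\<close> and \<open>Z\<close> has law \<^term>\<open>symmetric_beta a\<close>. It differs from \<open>u\<close> by a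
  function that is odd about \<open>1/2\<close>.
\<close>

definition cubic_weight :: "real \<Rightarrow> real \<Rightarrow> real" where
  "cubic_weight s u = u * (1 + s * ((1 - u) * (1 - 2 * u)))"

lemma measurable_tilt [measurable]: "tilt a \<in> borel_measurable borel"
  unfolding tilt_def by measurable

lemma measurable_cubic_weight [measurable]: "cubic_weight s \<in> borel_measurable borel"
  unfolding cubic_weight_def by measurable

lemma cubic_weight_reflect: "cubic_weight s u + cubic_weight s (1 - u) = 1"
  by (simp add: cubic_weight_def algebra_simps)

lemma cubic_weight_nonneg:
  assumes "0 \<le> s" "s \<le> 1" "0 \<le> u" "u \<le> 1"
  shows "cubic_weight s u \<ge> 0"
proof -
  have "(1 - u) * (1 - 2 * u) \<ge> -1"
  proof -
    have "(1 - u) * (1 - 2 * u) + 1 = 2 * (u - 3/4)\<^sup>2 + 7/8"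
      by (simp add: power2_eq_square algebra_simps)
    also have "\<dots> \<ge> 0" by simp
    finally show ?thesis by linarith
  qed
  then have "s * ((1 - u) * (1 - 2 * u)) \<ge> s * -1"
    using assms by (intro mult_left_mono) auto
  then show ?thesis
    unfolding cubic_weight_def using assms by (intro mult_nonneg_nonneg) auto
qed

text \<open>
  The bound on \<open>s\<close> is the reciprocal of the coefficient of the only negative term of \<^const>\<open>tilt\<close>.
\<close>

lemma tilt_nonneg:
  assumes "a > 0" "0 \<le> s" "s \<le> 1 / (3 * (a + 1))" "0 \<le> y" "y \<le> 1"
  shows "1 + s * tilt a y \<ge> 0"
proof -
  have "3 * (a + 1) * y \<le> 3 * (a + 1)" using assms by (simp add: mult_left_le)
  moreover have "0 \<le> (a + 1) * (a + 2) * y\<^sup>2" using assms by simp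
  ultimately have "tilt a y \<ge> - (3 * (a + 1))" by (simp add: tilt_def)
  then have "s * tilt a y \<ge> s * - (3 * (a + 1))"
    using assms(2) by (rule mult_left_mono)
  moreover have "s * (3 * (a + 1)) \<le> 1" using assms by (simp add: field_simps)
  ultimately show ?thesis unfolding mult_minus_right by linarith
qed

lemma has_integral_powr_tilt:
  assumes a: "a > 0" and d: "d \<ge> 0"
  shows "((\<lambda>r. r powr (a - 1) * (1 + s * tilt a (d - r))) has_integral
    d powr (a - 1) * cubic_weight s d / a) {0..d}"
proof -
  \<comment> \<open>The coefficients of \<open>1 + s * tilt a (d - r)\<close> as a polynomial in \<open>r\<close>.\<close>
  define c0 where "c0 = 1 + s * (1 - 3 * (a + 1) * d + (a + 1) * (a + 2) * d\<^sup>2)"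
  define c1 where "c1 = s * (3 * (a + 1) - 2 * (a + 1) * (a + 2) * d)"
  define c2 where "c2 = s * (a + 1) * (a + 2)"
  have "((\<lambda>r. c0 * r powr (a - 1) + c1 * r powr a + c2 * r powr (a + 1)) has_integral
      c0 * (d powr (a - 1 + 1) / (a - 1 + 1)) + c1 * (d powr (a + 1) / (a + 1)) +
      c2 * (d powr (a + 1 + 1) / (a + 1 + 1))) {0..d}"
    using a d by (intro has_integral_add has_integral_mult_right has_integral_powr_from_0) auto
  also have "c0 * (d powr (a - 1 + 1) / (a - 1 + 1)) + c1 * (d powr (a + 1) / (a + 1)) +
      c2 * (d powr (a + 1 + 1) / (a + 1 + 1)) = d powr (a - 1) * cubic_weight s d / a"
  proof (cases "d = 0")
    case False
    then have powr: "d powr (a - 1 + 1) = d powr (a - 1) * d" "d powr (a + 1) = d powr (a - 1) * d\<^sup>2"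
      "d powr (a + 1 + 1) = d powr (a - 1) * d ^ 3"
      using d by (simp_all add: powr_diff powr_add power2_eq_square power3_eq_cube)
    have c12: "c1 / (a + 1) = s * (3 - 2 * (a + 2) * d)" "c2 / (a + 1 + 1) = s * (a + 1)"
      using a by (simp_all add: c1_def c2_def field_simps)
    have "c0 * (d / a) + d\<^sup>2 * (c1 / (a + 1)) + d ^ 3 * (c2 / (a + 1 + 1)) = cubic_weight s d / a"
      unfolding c12 using a
      by (simp add: c0_def cubic_weight_def field_simps power2_eq_square power3_eq_cube)
    then have "d powr (a - 1) * (c0 * (d / a) + d\<^sup>2 * (c1 / (a + 1)) + d ^ 3 * (c2 / (a + 1 + 1))) =
        d powr (a - 1) * (cubic_weight s d / a)" by simp
    then show ?thesis unfolding powr by (simp add: algebra_simps)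
  qed (use a in \<open>simp add: cubic_weight_def\<close>)
  finally show ?thesis
  proof (rule has_integral_eq[rotated])
    fix r assume r: "r \<in> {0..d}"
    have powr: "r powr a = r powr (a - 1) * r" "r powr (a + 1) = r powr (a - 1) * r\<^sup>2"
      using r by (cases "r = 0"; simp add: powr_diff powr_add power2_eq_square)+
    show "c0 * r powr (a - 1) + c1 * r powr a + c2 * r powr (a + 1) =
        r powr (a - 1) * (1 + s * tilt a (d - r))"
      unfolding powr c0_def c1_def c2_def tilt_def by (simp add: algebra_simps power2_eq_square)
  qed
qed

lemma nn_integral_powr_tilt:
  assumes a: "a > 0" and s: "0 \<le> s" "s \<le> 1 / (3 * (a + 1))" and d: "0 \<le> d" "d \<le> 1"
  shows "(\<integral>\<^sup>+r. ennreal (r powr (a - 1) * (1 + s * tilt a (d - r))) * indicator {0..d} r \<partial>lborel) =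
    ennreal (d powr (a - 1) * cubic_weight s d / a)"
proof -
  have nonneg: "0 \<le> r powr (a - 1) * (1 + s * tilt a (d - r))" if "r \<in> {0..d}" for r
    using that d by (intro mult_nonneg_nonneg tilt_nonneg a s) auto
  let ?h = "\<lambda>r. if r \<in> {0..d} then r powr (a - 1) * (1 + s * tilt a (d - r)) else 0"
  have "(?h has_integral d powr (a - 1) * cubic_weight s d / a) UNIV"
    using has_integral_powr_tilt[OF a d(1)] by (simp only: has_integral_restrict_UNIV)
  then have "(\<integral>\<^sup>+r. ennreal (?h r) \<partial>lborel) = ennreal (d powr (a - 1) * cubic_weight s d / a)"
    using nonneg by (intro nn_integral_has_integral_lborel) auto
  also have "(\<integral>\<^sup>+r. ennreal (?h r) \<partial>lborel) =
      (\<integral>\<^sup>+r. ennreal (r powr (a - 1) * (1 + s * tilt a (d - r))) * indicator {0..d} r \<partial>lborel)"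
    by (intro nn_integral_cong) (auto simp: indicator_def)
  finally show ?thesis .
qed

lemma Beta_pos: "a > 0 \<Longrightarrow> Beta a a > (0 :: real)"
  by (simp add: Beta_def Gamma_real_pos)

section \<open>The symmetric beta law\<close>

lemma prob_on_unit_densityI:
  assumes [measurable]: "f \<in> borel_measurable borel"
    and mass: "(\<integral>\<^sup>+x. f x * indicator {0..1} x \<partial>lborel) = 1"
  shows "prob_on_unit (density lborel (\<lambda>x. f x * indicator {0..1} x))"
  unfolding prob_on_unit_def
  by (auto intro!: prob_spaceI simp: emeasure_density mass mult.assoc simp flip: indicator_inter_arith)

lemma prob_on_unit_symmetric_beta:
  assumes a: "a > 0"
  shows "prob_on_unit (symmetric_beta a)"
proof -
  let ?h = "\<lambda>x::real. if x \<in> {0..1} then x powr (a - 1) * (1 - x) powr (a - 1) / Beta a a else 0"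
  have "((\<lambda>x. x powr (a - 1) * (1 - x) powr (a - 1) / Beta a a) has_integral (Beta a a / Beta a a)) {0..1}"
    using has_integral_Beta_real[OF a a] by (rule has_integral_divide)
  then have "(?h has_integral 1) UNIV"
    using Beta_pos[OF a] by (simp only: has_integral_restrict_UNIV) simp
  then have "(\<integral>\<^sup>+x. ennreal (?h x) \<partial>lborel) = ennreal 1"
    using Beta_pos[OF a] by (intro nn_integral_has_integral_lborel) auto
  also have "(\<integral>\<^sup>+x. ennreal (?h x) \<partial>lborel) =
      (\<integral>\<^sup>+x. ennreal (x powr (a - 1) * (1 - x) powr (a - 1) / Beta a a) * indicator {0..1} x \<partial>lborel)"
    by (intro nn_integral_cong) (auto simp: indicator_def)
  finally show ?thesis
    unfolding symmetric_beta_def by (intro prob_on_unit_densityI) auto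
qed

lemma nn_integral_symmetric_beta_reflect:
  assumes [measurable]: "h \<in> borel_measurable borel"
  shows "(\<integral>\<^sup>+z. h (1 - z) \<partial>symmetric_beta a) = (\<integral>\<^sup>+z. h z \<partial>symmetric_beta a)"
proof -
  let ?l = "\<lambda>x. ennreal (x powr (a - 1) * (1 - x) powr (a - 1) / Beta a a) * indicator {0..1} x"
  have "(\<integral>\<^sup>+z. h z \<partial>symmetric_beta a) = (\<integral>\<^sup>+z. ?l z * h z \<partial>lborel)"
    unfolding symmetric_beta_def by (subst nn_integral_density) auto
  also have "\<dots> = ennreal \<bar>-1\<bar> * (\<integral>\<^sup>+z. ?l (1 + (-1) * z) * h (1 + (-1) * z) \<partial>lborel)"
    by (rule nn_integral_real_affine) auto
  also have "\<dots> = (\<integral>\<^sup>+z. ?l z * h (1 - z) \<partial>lborel)"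
    by (simp, intro nn_integral_cong) (auto simp: indicator_def mult_ac)
  also have "\<dots> = (\<integral>\<^sup>+z. h (1 - z) \<partial>symmetric_beta a)"
    unfolding symmetric_beta_def by (subst nn_integral_density) auto
  finally show ?thesis ..
qed

section \<open>The symmetric beta law solves the equation\<close>

text \<open>
  The law of \<open>(1 - Y) Z\<close>. With \<open>v = 1 - y\<close> and \<open>x = v z\<close>, the exponent \<open>2 a - 1\<close> is exactly the one
  for which all powers of \<open>v\<close> cancel, so only \<open>x^(a - 1) (v - x)^(a - 1)\<close> and the polynomial factor
  remain. Integrating over \<open>v\<close> from \<open>x\<close> to \<open>1\<close> is then the integral of \<open>nn_integral_powr_tilt\<close> with
  \<open>d = 1 - x\<close> and \<open>r = v - x\<close>.
\<close>

lemma nn_integral_tilted_beta_mult_symmetric_beta: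
  assumes a: "a > 0" and s: "0 \<le> s" "s \<le> 1 / (3 * (a + 1))"
    and g [measurable]: "g \<in> borel_measurable borel"
  shows "(\<integral>\<^sup>+y. \<integral>\<^sup>+z. g ((1 - y) * z) \<partial>symmetric_beta a \<partial>tilted_beta a s) =
    (\<integral>\<^sup>+x. g x * ennreal (2 * cubic_weight s (1 - x)) \<partial>symmetric_beta a)"
proof -
  define B where "B = Beta a a"
  have B: "B > 0" using Beta_pos[OF a] by (simp add: B_def)
  define l :: "real \<Rightarrow> ennreal" where
    "l = (\<lambda>x. ennreal (x powr (a - 1) * (1 - x) powr (a - 1) / B) * indicator {0..1} x)"
  define n :: "real \<Rightarrow> ennreal" where
    "n = (\<lambda>y. ennreal (2 * a * (1 - y) powr (2 * a - 1) * (1 + s * tilt a y)) * indicator {0..1} y)"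
  have [measurable]: "l \<in> borel_measurable borel" "n \<in> borel_measurable borel"
    unfolding l_def n_def by measurable
  have sym: "symmetric_beta a = density lborel l" and tilted: "tilted_beta a s = density lborel n"
    unfolding symmetric_beta_def tilted_beta_def l_def n_def B_def by auto
  \<comment> \<open>The joint density of \<open>x = (1 - y) z\<close> and \<open>y\<close>.\<close>
  define K where "K x y = n y * (ennreal (1 / (1 - y)) * l (x / (1 - y)))" for x y
  have [measurable]: "(\<lambda>(x, y). K x y) \<in> borel_measurable (borel \<Otimes>\<^sub>M borel)"
    unfolding K_def by measurable
  have kernel: "(\<integral>\<^sup>+y. K x y \<partial>lborel) = l x * ennreal (2 * cubic_weight s (1 - x))" if "x \<noteq> 0" for x
  proof (cases "0 < x \<and> x \<le> 1")
    case False
    then have "K x y = 0" for y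
      using that by (auto simp: K_def l_def n_def indicator_def divide_less_0_iff zero_le_divide_iff)
    moreover have "l x = 0"
      using that False by (auto simp: l_def)
    ultimately show ?thesis by simp
  next
    case True
    have K: "K x (1 - x - r) = ennreal (2 * a * x powr (a - 1) / B) *
        (ennreal (r powr (a - 1) * (1 + s * tilt a (1 - x - r))) * indicator {0..1-x} r)" for r
    proof (cases "0 \<le> r \<and> r \<le> 1 - x")
      case False
      have "n (1 - x - r) = 0" if "r > 1 - x" using that by (simp add: n_def)
      moreover have "ennreal (1 / (x + r)) * l (x / (x + r)) = 0" if "r < 0"
        using that True by (cases "x + r \<le> 0") (auto simp: l_def ennreal_neg field_simps)
      ultimately show ?thesis using False by (auto simp: K_def not_le)
    next
      case r: True
      \<comment> \<open>Here \<open>v = 1 - y\<close>, as \<open>y = 1 - x - r\<close>.\<close>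
      define v where "v = x + r"
      have v: "0 < v" "v \<le> 1" using True r by (auto simp: v_def)
      have exps: "v powr (2 * a - 1) * (1 / v) * (x / v) powr (a - 1) * (r / v) powr (a - 1) =
          x powr (a - 1) * r powr (a - 1)"
      proof -
        have "v powr (2 * a - 1) = v powr (a - 1) * v powr (a - 1) * v"
          using v by (simp add: powr_mult_base mult.commute flip: powr_add)
        then show ?thesis using v True r by (simp add: powr_divide)
      qed
      have "x / v \<le> 1" "1 - x / v = r / v" using True r v by (auto simp: v_def field_simps)
      then have "l (x / v) = ennreal ((x / v) powr (a - 1) * (r / v) powr (a - 1) / B)"
        using True v by (simp add: l_def)
      moreover have "n (1 - v) = ennreal (2 * a * v powr (2 * a - 1) * (1 + s * tilt a (1 - v)))"
        using v by (simp add: n_def)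
      moreover have "ennreal (2 * a * v powr (2 * a - 1) * (1 + s * tilt a (1 - v)) *
            ((1 / v) * ((x / v) powr (a - 1) * (r / v) powr (a - 1) / B))) =
          ennreal (2 * a * v powr (2 * a - 1) * (1 + s * tilt a (1 - v))) *
            (ennreal (1 / v) * ennreal ((x / v) powr (a - 1) * (r / v) powr (a - 1) / B))"
        using a B v tilt_nonneg[OF a s, of "1 - v"]
        by (subst ennreal_mult, simp, simp, subst ennreal_mult) auto
      ultimately have "K x (1 - v) = ennreal (2 * a * v powr (2 * a - 1) * (1 + s * tilt a (1 - v)) *
          ((1 / v) * ((x / v) powr (a - 1) * (r / v) powr (a - 1) / B)))"
        by (simp only: K_def diff_diff_eq2 add_diff_cancel_left')
      also have "\<dots> = ennreal (2 * a / B * (1 + s * tilt a (1 - v)) *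
          (v powr (2 * a - 1) * (1 / v) * (x / v) powr (a - 1) * (r / v) powr (a - 1)))"
      proof -
        have "2 * a * P * T * ((1 / v) * (X * R / B)) = 2 * a / B * T * (P * (1 / v) * X * R)"
          for P T X R by (simp only: mult_ac times_divide_eq_left times_divide_eq_right
              divide_divide_eq_left mult_1_left)
        then show ?thesis by (simp only:)
      qed
      also have "\<dots> = ennreal (2 * a * x powr (a - 1) / B * (r powr (a - 1) * (1 + s * tilt a (1 - v))))"
      proof -
        have "2 * a / B * T * (X * R) = 2 * a * X / B * (R * T)" for T X R
          by (simp only: mult_ac times_divide_eq_left times_divide_eq_right)
        then show ?thesis unfolding exps by (simp only:)
      qed
      also have "\<dots> = ennreal (2 * a * x powr (a - 1) / B) * ennreal (r powr (a - 1) * (1 + s * tilt a (1 - v)))"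
        using a B v tilt_nonneg[OF a s, of "1 - v"] by (intro ennreal_mult) auto
      finally show ?thesis using r by (simp add: v_def algebra_simps)
    qed
    have "(\<integral>\<^sup>+y. K x y \<partial>lborel) = ennreal \<bar>-1\<bar> * (\<integral>\<^sup>+r. K x ((1 - x) + (-1) * r) \<partial>lborel)"
      by (rule nn_integral_real_affine) auto
    also have "\<dots> = ennreal (2 * a * x powr (a - 1) / B) *
        (\<integral>\<^sup>+r. ennreal (r powr (a - 1) * (1 + s * tilt a (1 - x - r))) * indicator {0..1-x} r \<partial>lborel)"
      by (simp add: K, subst nn_integral_cmult) auto
    also have "\<dots> = ennreal (2 * a * x powr (a - 1) / B) *
        ennreal ((1 - x) powr (a - 1) * cubic_weight s (1 - x) / a)"
      using True by (subst nn_integral_powr_tilt[OF a s]) auto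
    also have "\<dots> = ennreal (x powr (a - 1) * (1 - x) powr (a - 1) / B) *
        ennreal (2 * cubic_weight s (1 - x))"
      using a B True by (subst (1 2) ennreal_mult'[symmetric]) (auto simp: field_simps)
    also have "\<dots> = l x * ennreal (2 * cubic_weight s (1 - x))"
      using True by (simp add: l_def)
    finally show ?thesis .
  qed
  have inner: "n y * (\<integral>\<^sup>+z. l z * g ((1 - y) * z) \<partial>lborel) = (\<integral>\<^sup>+x. g x * K x y \<partial>lborel)"
    if "y \<noteq> 1" for y
  proof (cases "y < 1")
    case False
    then have "n y = 0" using that by (auto simp: n_def)
    then show ?thesis by (simp add: K_def)
  next
    case True
    then have "(\<integral>\<^sup>+z. l z * g ((1 - y) * z) \<partial>lborel) = ennreal \<bar>1 / (1 - y)\<bar> *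
        (\<integral>\<^sup>+x. l (0 + (1 / (1 - y)) * x) * g ((1 - y) * (0 + (1 / (1 - y)) * x)) \<partial>lborel)"
      by (intro nn_integral_real_affine) auto
    also have "\<dots> = ennreal (1 / (1 - y)) * (\<integral>\<^sup>+x. l (x / (1 - y)) * g x \<partial>lborel)"
      using True by simp
    also have "n y * \<dots> = (\<integral>\<^sup>+x. n y * (ennreal (1 / (1 - y)) * (l (x / (1 - y)) * g x)) \<partial>lborel)"
      by (simp add: nn_integral_cmult)
    finally show ?thesis by (simp add: K_def mult_ac)
  qed
  have "(\<integral>\<^sup>+y. \<integral>\<^sup>+z. g ((1 - y) * z) \<partial>symmetric_beta a \<partial>tilted_beta a s) =
      (\<integral>\<^sup>+y. n y * (\<integral>\<^sup>+z. l z * g ((1 - y) * z) \<partial>lborel) \<partial>lborel)"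
    unfolding sym tilted by (simp add: nn_integral_density)
  also have "\<dots> = (\<integral>\<^sup>+y. \<integral>\<^sup>+x. g x * K x y \<partial>lborel \<partial>lborel)"
    using AE_lborel_singleton[of "1::real"] inner
    by (intro nn_integral_cong_AE) (auto elim: eventually_mono)
  also have "\<dots> = (\<integral>\<^sup>+x. \<integral>\<^sup>+y. g x * K x y \<partial>lborel \<partial>lborel)"
    by (rule lborel_pair.Fubini') measurable
  also have "\<dots> = (\<integral>\<^sup>+x. g x * (\<integral>\<^sup>+y. K x y \<partial>lborel) \<partial>lborel)"
    by (simp add: nn_integral_cmult)
  also have "\<dots> = (\<integral>\<^sup>+x. l x * (g x * ennreal (2 * cubic_weight s (1 - x))) \<partial>lborel)"
    using AE_lborel_singleton[of "0::real"] kernel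
    by (intro nn_integral_cong_AE) (auto elim!: eventually_mono simp: mult_ac)
  also have "\<dots> = (\<integral>\<^sup>+x. g x * ennreal (2 * cubic_weight s (1 - x)) \<partial>symmetric_beta a)"
    unfolding sym by (subst nn_integral_density) auto
  finally show ?thesis .
qed

text \<open>
  Reflecting \<open>Z\<close> turns \<open>Y + (1 - Y) Z\<close> into \<open>1 - (1 - Y) Z\<close>. Hence the right-hand side of the equation
  is the mean of the laws of \<open>(1 - Y) Z\<close> and of its reflection, with density
  \<open>w(1 - x) + w(x) = 1\<close> with respect to the law of \<open>Z\<close>, where \<open>w\<close> is \<^term>\<open>cubic_weight s\<close>.
\<close>

lemma residual_fixpoint_symmetric_beta:
  assumes a: "a > 0" and s: "0 \<le> s" "s \<le> 1 / (3 * (a + 1))"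
  shows "residual_fixpoint (1/2) (tilted_beta a s) (symmetric_beta a)"
  unfolding residual_fixpoint_def
proof
  fix f :: "real \<Rightarrow> ennreal" assume f [measurable]: "f \<in> borel_measurable borel"
  let ?L = "symmetric_beta a"
  have [measurable_cong]: "sets ?L = sets borel" by (simp add: symmetric_beta_def)
  have unit: "AE x in ?L. 0 \<le> x \<and> x \<le> 1"
    unfolding symmetric_beta_def by (subst AE_density) (auto simp: indicator_def)
  have "1 / (3 * (a + 1)) \<le> 1" using a by simp
  then have s1: "s \<le> 1" using s(2) by linarith
  define g where "g x = (f (1 - x) + f x) * ennreal (1/2)" for x
  have [measurable]: "g \<in> borel_measurable borel" unfolding g_def by measurable
  have "(\<integral>\<^sup>+z. f (y + (1 - y) * z) \<partial>?L) * ennreal (1/2) +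
      (\<integral>\<^sup>+z. f ((1 - y) * z) \<partial>?L) * ennreal (1 - 1/2) = (\<integral>\<^sup>+z. g ((1 - y) * z) \<partial>?L)" for y
  proof -
    have "(\<integral>\<^sup>+z. f (y + (1 - y) * z) \<partial>?L) = (\<integral>\<^sup>+z. f (y + (1 - y) * (1 - z)) \<partial>?L)"
      by (rule nn_integral_symmetric_beta_reflect[symmetric]) measurable
    also have "\<dots> = (\<integral>\<^sup>+z. f (1 - (1 - y) * z) \<partial>?L)" by (simp add: algebra_simps)
    finally show ?thesis
      unfolding g_def by (simp add: nn_integral_multc nn_integral_add distrib_right)
  qed
  then have "(\<integral>\<^sup>+y. (\<integral>\<^sup>+z. f (y + (1 - y) * z) \<partial>?L) * ennreal (1/2) +
      (\<integral>\<^sup>+z. f ((1 - y) * z) \<partial>?L) * ennreal (1 - 1/2) \<partial>tilted_beta a s) =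
      (\<integral>\<^sup>+y. \<integral>\<^sup>+z. g ((1 - y) * z) \<partial>?L \<partial>tilted_beta a s)"
    by (intro nn_integral_cong)
  also have "\<dots> = (\<integral>\<^sup>+x. g x * ennreal (2 * cubic_weight s (1 - x)) \<partial>?L)"
    by (rule nn_integral_tilted_beta_mult_symmetric_beta[OF a s]) measurable
  also have "\<dots> = (\<integral>\<^sup>+x. f (1 - x) * ennreal (cubic_weight s (1 - x)) +
      f x * ennreal (cubic_weight s (1 - x)) \<partial>?L)"
  proof (rule nn_integral_cong)
    fix x
    have "ennreal (1/2) * ennreal (2 * cubic_weight s (1 - x)) = ennreal (cubic_weight s (1 - x))"
      by (subst ennreal_mult'[symmetric]) auto
    then show "g x * ennreal (2 * cubic_weight s (1 - x)) =
        f (1 - x) * ennreal (cubic_weight s (1 - x)) + f x * ennreal (cubic_weight s (1 - x))"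
      by (simp only: g_def mult.assoc distrib_right)
  qed
  also have "\<dots> = (\<integral>\<^sup>+x. f (1 - x) * ennreal (cubic_weight s (1 - x)) \<partial>?L) +
      (\<integral>\<^sup>+x. f x * ennreal (cubic_weight s (1 - x)) \<partial>?L)"
    by (rule nn_integral_add) auto
  also have "(\<integral>\<^sup>+x. f (1 - x) * ennreal (cubic_weight s (1 - x)) \<partial>?L) =
      (\<integral>\<^sup>+x. f x * ennreal (cubic_weight s x) \<partial>?L)"
    by (rule nn_integral_symmetric_beta_reflect) auto
  also have "(\<integral>\<^sup>+x. f x * ennreal (cubic_weight s x) \<partial>?L) +
      (\<integral>\<^sup>+x. f x * ennreal (cubic_weight s (1 - x)) \<partial>?L) =
      (\<integral>\<^sup>+x. f x * ennreal (cubic_weight s x) + f x * ennreal (cubic_weight s (1 - x)) \<partial>?L)"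
    by (rule nn_integral_add[symmetric]) auto
  also have "\<dots> = (\<integral>\<^sup>+x. f x \<partial>?L)"
  proof (rule nn_integral_cong_AE, use unit in eventually_elim)
    case (elim x)
    have "ennreal (cubic_weight s x) + ennreal (cubic_weight s (1 - x)) = 1"
      using elim s(1) s1 cubic_weight_reflect[of s x]
      by (subst ennreal_plus[symmetric]) (auto intro!: cubic_weight_nonneg)
    then show ?case by (simp flip: distrib_left)
  qed
  finally show "(\<integral>\<^sup>+z. f z \<partial>?L) =
     (\<integral>\<^sup>+y. (\<integral>\<^sup>+z. f (y + (1 - y) * z) \<partial>?L) * ennreal (1/2) +
           (\<integral>\<^sup>+z. f ((1 - y) * z) \<partial>?L) * ennreal (1 - 1/2) \<partial>tilted_beta a s)" ..
qed

text \<open>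
  Tested against the constant \<open>1\<close>, the equation gives the total mass: that of \<^term>\<open>symmetric_beta a\<close>
  is \<open>1\<close> and equals itself times that of \<^term>\<open>tilted_beta a s\<close>.
\<close>

lemma prob_on_unit_tilted_beta:
  assumes a: "a > 0" and s: "0 \<le> s" "s \<le> 1 / (3 * (a + 1))"
  shows "prob_on_unit (tilted_beta a s)"
proof -
  have "prob_space (symmetric_beta a)"
    using prob_on_unit_symmetric_beta[OF a] by (simp add: prob_on_unit_def)
  then have one: "(\<integral>\<^sup>+z. 1 \<partial>symmetric_beta a) = 1"
    by (simp add: prob_space.emeasure_space_1)
  have half: "ennreal (1/2) + ennreal (1 - 1/2) = 1"
    by (subst ennreal_plus[symmetric]) auto
  have "(\<integral>\<^sup>+y. 1 \<partial>tilted_beta a s) = 1"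
    using residual_fixpoint_symmetric_beta[OF assms, unfolded residual_fixpoint_def,
        THEN bspec, of "\<lambda>_. 1"]
    unfolding one by (simp only: mult_1 half) simp
  then have "(\<integral>\<^sup>+y. ennreal (2 * a * (1 - y) powr (2 * a - 1) * (1 + s * tilt a y)) *
      indicator {0..1} y \<partial>lborel) = 1"
    unfolding tilted_beta_def by (subst (asm) nn_integral_density) auto
  then show ?thesis
    unfolding tilted_beta_def by (intro prob_on_unit_densityI) auto
qed

lemma tilted_beta_0: "tilted_beta a 0 = beta_one (2 * a)"
  by (simp add: tilted_beta_def beta_one_def)

lemma emeasure_tilted_beta_singleton: "emeasure (tilted_beta a s) {x} = 0"
proof -
  have "emeasure (tilted_beta a s) {x} =
      (\<integral>\<^sup>+y. ennreal (2 * a * (1 - y) powr (2 * a - 1) * (1 + s * tilt a y)) *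
      indicator {0..1} y * indicator {x} y \<partial>lborel)"
    unfolding tilted_beta_def by (rule emeasure_density) auto
  also have "\<dots> = (\<integral>\<^sup>+y. 0 \<partial>(lborel :: real measure))"
    using AE_lborel_singleton[of x] by (intro nn_integral_cong_AE) (auto elim: eventually_mono)
  finally show ?thesis by simp
qed

text \<open>
  Near \<open>0\<close> the polynomial \<^term>\<open>tilt a\<close> is positive, so there the densities for two values of \<open>s\<close>
  differ everywhere.
\<close>

lemma inj_on_tilted_beta:
  assumes a: "a > 0"
  shows "inj_on (tilted_beta a) {0..1 / (3 * (a + 1))}"
proof
  fix s s' assume s: "s \<in> {0..1 / (3 * (a + 1))}" "s' \<in> {0..1 / (3 * (a + 1))}"
    and eq: "tilted_beta a s = tilted_beta a s'"
  let ?d = "\<lambda>s y. 2 * a * (1 - y) powr (2 * a - 1) * (1 + s * tilt a y)"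
  have "AE y in lborel. ennreal (?d s y) * indicator {0..1} y = ennreal (?d s' y) * indicator {0..1} y"
    using eq unfolding tilted_beta_def
    by (intro sigma_finite_measure.density_unique[OF sigma_finite_lborel]) auto
  moreover have "\<not> (ennreal (?d s y) * indicator {0..1} y = ennreal (?d s' y) * indicator {0..1} y)"
    if "s \<noteq> s'" and y: "y \<in> {0<..<1 / (3 * (a + 1))}" for y
  proof -
    have "1 / (3 * (a + 1)) < 1" using a by simp
    then have y1: "y < 1" "0 < y" using y by auto
    have "3 * (a + 1) * y < 1" using y a by (simp add: field_simps)
    moreover have "0 \<le> (a + 1) * (a + 2) * y\<^sup>2" using a by simp
    ultimately have "tilt a y > 0" by (simp add: tilt_def)
    moreover have "1 + s * tilt a y \<ge> 0" "1 + s' * tilt a y \<ge> 0"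
      using s a y1 by (auto intro!: tilt_nonneg)
    ultimately show ?thesis using that y1 a by auto
  qed
  ultimately have "AE y in lborel. y \<notin> {0<..<1 / (3 * (a + 1))}" if "s \<noteq> s'"
    using that by (auto elim!: eventually_mono)
  then have "emeasure lborel {0<..<1 / (3 * (a + 1))} = 0" if "s \<noteq> s'"
    using that by (subst (asm) AE_iff_null_sets[symmetric]) (auto dest: null_setsD1)
  then show "s = s'" using a by auto
qed

section \<open>Laws with the same Bernoulli convolution\<close>

lemma bernoulli_convolution_tilted_beta:
  assumes a: "a > 0" and s: "0 \<le> s" "s \<le> 1 / (3 * (a + 1))"
  shows "bernoulli_convolution (1/2) (residual_allocation_model (tilted_beta a s)) =
    symmetric_beta a"
proof (rule residual_fixpoint_unique)
  show \<nu>: "prob_on_unit (tilted_beta a s)"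
    by (rule prob_on_unit_tilted_beta[OF assms])
  show "residual_fixpoint (1/2) (tilted_beta a s)
      (bernoulli_convolution (1/2) (residual_allocation_model (tilted_beta a s)))"
    by (rule residual_fixpoint_bernoulli_convolution[OF \<nu>]) auto
  show "prob_on_unit (bernoulli_convolution (1/2) (residual_allocation_model (tilted_beta a s)))"
    by (rule prob_on_unit_bernoulli_convolution[OF \<nu>])
  show "residual_fixpoint (1/2) (tilted_beta a s) (symmetric_beta a)"
    by (rule residual_fixpoint_symmetric_beta[OF assms])
  show "prob_on_unit (symmetric_beta a)"
    by (rule prob_on_unit_symmetric_beta[OF a])
qed (simp_all add: emeasure_tilted_beta_singleton)

theorem theorem1p2:
  fixes \<theta> :: real
  assumes "\<theta> > 0"
  shows "infinite {\<nu>. prob_on_unit \<nu> \<and> \<nu> \<noteq> beta_one \<theta> \<and> emeasure \<nu> {0} = 0 \<and>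
    bernoulli_convolution (1/2) (residual_allocation_model (beta_one \<theta>)) =
    bernoulli_convolution (1/2) (residual_allocation_model \<nu>)}"
proof -
  let ?N = "{\<nu>. prob_on_unit \<nu> \<and> \<nu> \<noteq> beta_one \<theta> \<and> emeasure \<nu> {0} = 0 \<and>
    bernoulli_convolution (1/2) (residual_allocation_model (beta_one \<theta>)) =
    bernoulli_convolution (1/2) (residual_allocation_model \<nu>)}"
  define a where "a = \<theta> / 2"
  have a: "a > 0" using assms by (simp add: a_def)
  define c where "c = 1 / (3 * (a + 1))"
  have c: "c > 0" using a by (simp add: c_def)
  have beta: "beta_one \<theta> = tilted_beta a 0" by (simp add: tilted_beta_0 a_def)
  have inj: "inj_on (tilted_beta a) {0..c}"
    unfolding c_def by (rule inj_on_tilted_beta[OF a])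
  have conv: "bernoulli_convolution (1/2) (residual_allocation_model (tilted_beta a s)) =
      symmetric_beta a" if "s \<in> {0..c}" for s
    using that by (intro bernoulli_convolution_tilted_beta a) (auto simp: c_def)
  have "tilted_beta a ` {0<..c} \<subseteq> ?N"
  proof safe
    fix s assume "s \<in> {0<..c}"
    then have s: "s \<in> {0..c}" "s \<noteq> 0" by auto
    show "prob_on_unit (tilted_beta a s)"
      using s by (intro prob_on_unit_tilted_beta a) (auto simp: c_def)
    show "emeasure (tilted_beta a s) {0} = 0"
      by (rule emeasure_tilted_beta_singleton)
    show "bernoulli_convolution (1/2) (residual_allocation_model (beta_one \<theta>)) =
        bernoulli_convolution (1/2) (residual_allocation_model (tilted_beta a s))"
      using s c by (simp add: beta conv)
    show False if "tilted_beta a s = beta_one \<theta>"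
      using inj_onD[OF inj that[unfolded beta]] s c by auto
  qed
  moreover have "infinite (tilted_beta a ` {0<..c})"
  proof (subst finite_image_iff)
    show "inj_on (tilted_beta a) {0<..c}"
      using inj by (rule inj_on_subset) auto
    show "infinite {0<..c}" using c by (rule infinite_Ioc)
  qed
  ultimately show ?thesis by (rule infinite_super)
qed

end
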